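(* Let $S=\{x_1,x_2,\dots,x_n\}$ be any set of $n$ distinct positive integers, let $m>0$ be a real number, and let $f(x)=x^{-m}$ for all positive integers $x$. Then (a) $[S]_f$ is positive definite; (b) $(S)_f$ is indefinite for $n\ge 2$.
   Context: $(S)_f$ is the $n\times n$ matrix with $ij$ entry $f(\gcd(x_i,x_j))$ (the GCD matrix), and $[S]_f$ is the $n\times n$ matrix with $ij$ entry $f(\operatorname{lcm}(x_i,x_j))$ (the LCM matrix). A real symmetric matrix is indefinite if it is neither positive semidefinite nor negative semidefinite. *)

theory Defs
  imports "HOL-Analysis.Analysis"
begin

text \<open>
  A finite set of \<open>n\<close> distinct positive integers is given by an enumeration \<open>x\<close> over a
  finite index type \<open>'n\<close> with \<open>n = CARD('n)\<close>; distinctness and positivity are assumed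
  where the matrices are used.
\<close>

definition gcd_matrix :: "('n::finite \<Rightarrow> nat) \<Rightarrow> (nat \<Rightarrow> real) \<Rightarrow> real ^ 'n ^ 'n" where
  "gcd_matrix x f = (\<chi> i j. f (gcd (x i) (x j)))"

definition lcm_matrix :: "('n::finite \<Rightarrow> nat) \<Rightarrow> (nat \<Rightarrow> real) \<Rightarrow> real ^ 'n ^ 'n" where
  "lcm_matrix x f = (\<chi> i j. f (lcm (x i) (x j)))"

text \<open>All definiteness notions include symmetry of the matrix.\<close>

definition symmetric_matrix :: "real ^ 'n ^ 'n \<Rightarrow> bool" where
  "symmetric_matrix A \<longleftrightarrow> transpose A = A"

definition positive_definite :: "real ^ 'n ^ 'n \<Rightarrow> bool" where
  "positive_definite A \<longleftrightarrow> symmetric_matrix A \<and> (\<forall>v. v \<noteq> 0 \<longrightarrow> v \<bullet> (A *v v) > 0)"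

definition positive_semidefinite :: "real ^ 'n ^ 'n \<Rightarrow> bool" where
  "positive_semidefinite A \<longleftrightarrow> symmetric_matrix A \<and> (\<forall>v. v \<bullet> (A *v v) \<ge> 0)"

definition negative_semidefinite :: "real ^ 'n ^ 'n \<Rightarrow> bool" where
  "negative_semidefinite A \<longleftrightarrow> symmetric_matrix A \<and> (\<forall>v. v \<bullet> (A *v v) \<le> 0)"

definition indefinite :: "real ^ 'n ^ 'n \<Rightarrow> bool" where
  "indefinite A \<longleftrightarrow> symmetric_matrix A \<and> \<not> positive_semidefinite A \<and> \<not> negative_semidefinite A"

end

theory Submission
  imports Defs
begin

text \<open>
  For positive integers \<open>a\<close>, \<open>b\<close> one has \<open>lcm a b = a b / gcd a b\<close>, so the LCM matrix of
  \<open>k \<mapsto> k\<^sup>-\<^sup>m\<close> is the matrix with entries \<open>gcd(x\<^sub>i, x\<^sub>j)\<^sup>m\<close>, multiplied from both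
  sides by the invertible diagonal matrix with entries \<open>x\<^sub>i\<^sup>-\<^sup>m\<close>. It therefore suffices that power GCD
  matrices with a positive exponent are positive definite. For these, Jordan's
  totient \<open>J\<close> of real order \<open>m\<close> is positive and satisfies the convolution identity
  \<open>n\<^sup>m = (\<Sum>d | d dvd n. J d)\<close> (lemma \<open>sum_jordan_totient\<close>). Since the common divisors
  of \<open>x\<^sub>i\<close> and \<open>x\<^sub>j\<close> are the divisors of their gcd, this turns the quadratic form into the
  weighted sum of squares \<open>\<Sum>d. J d * (\<Sum>i | d dvd x\<^sub>i. w\<^sub>i)\<^sup>2\<close>. It vanishes only at
  \<open>w = 0\<close>: if \<open>x\<^sub>k\<close> is maximal among the \<open>x\<^sub>i\<close> with \<open>w\<^sub>i \<noteq> 0\<close>, then the inner sum for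
  \<open>d = x\<^sub>k\<close> has the single nonzero term \<open>w\<^sub>k\<close>.

  The GCD matrix has positive diagonal entries, hence is not negative semidefinite.
  For distinct \<open>a\<close>, \<open>b\<close> one has \<open>gcd(a, b)\<^sup>2 < a b\<close>, so every \<open>2 \<times> 2\<close> principal minor
  \<open>(a b)\<^sup>-\<^sup>m - gcd(a, b)\<^sup>-\<^sup>2\<^sup>m\<close> is negative, which excludes positive semidefiniteness.
\<close>

section \<open>Jordan's totient of real order\<close>

text \<open>
  For \<open>m = 1\<close> this is Euler's totient. Jordan's counting definition needs a natural \<open>m\<close>;
  the product formula makes sense, and is positive, for every real \<open>m > 0\<close>.
\<close>

definition jordan_totient :: "real \<Rightarrow> nat \<Rightarrow> real" where
  "jordan_totient m n = real n powr m * (\<Prod>p\<in>prime_factors n. 1 - real p powr (- m))"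

lemma jordan_totient_pos:
  assumes "m > 0" "n > 0"
  shows "jordan_totient m n > 0"
proof -
  have "1 - real p powr (- m) > 0" if "p \<in> prime_factors n" for p
  proof -
    have "real p > 1"
      using that prime_gt_1_nat by fastforce
    then have "real p powr (- m) < real p powr 0"
      using assms(1) by (intro powr_less_mono) auto
    then show ?thesis
      using \<open>real p > 1\<close> by simp
  qed
  then show ?thesis
    using assms unfolding jordan_totient_def by (intro mult_pos_pos prod_pos) auto
qed

lemma jordan_totient_prime_power_mult:
  assumes "prime p" "\<not> p dvd e" "e > 0"
  shows "jordan_totient m (p ^ Suc k * e)
    = (real (p ^ Suc k) powr m - real (p ^ k) powr m) * jordan_totient m e"
proof -
  have "p > 0"
    using assms(1) prime_gt_0_nat by blast
  have factors: "prime_factors (p ^ Suc k * e) = insert p (prime_factors e)"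
    using assms \<open>p > 0\<close>
    by (subst prime_factors_product) (auto simp: prime_factorization_prime_power simp del: power_Suc)
  have "p \<notin> prime_factors e"
    using assms(2) by auto
  then have "jordan_totient m (p ^ Suc k * e)
    = real (p ^ Suc k) powr m * (1 - real p powr (- m)) * jordan_totient m e"
    unfolding jordan_totient_def factors by (simp add: powr_mult)
  moreover have "real (p ^ Suc k) powr m * (1 - real p powr (- m))
    = real (p ^ Suc k) powr m - real (p ^ k) powr m"
    using \<open>p > 0\<close> by (simp add: powr_mult algebra_simps powr_minus)
  ultimately show ?thesis
    by simp
qed

text \<open>
  The divisors gained when one more prime factor \<open>p\<close> is added are those in which \<open>p\<close> occurs
  with the full exponent. This splits the divisor sum below into a sum for a smaller number
  and a sum over the divisors of the part coprime to \<open>p\<close>.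
\<close>

lemma divisors_prime_mult:
  fixes p e :: nat
  assumes "prime p" "\<not> p dvd e"
  shows "{d. d dvd p ^ Suc k * e}
    = {d. d dvd p ^ k * e} \<union> (\<lambda>c. p ^ Suc k * c) ` {c. c dvd e}"
    and "{d. d dvd p ^ k * e} \<inter> (\<lambda>c. p ^ Suc k * c) ` {c. c dvd e} = {}"
proof -
  have "p > 0"
    using assms(1) prime_gt_0_nat by blast
  show "{d. d dvd p ^ Suc k * e}
    = {d. d dvd p ^ k * e} \<union> (\<lambda>c. p ^ Suc k * c) ` {c. c dvd e}" (is "?L = ?R")
  proof
    show "?L \<subseteq> ?R"
    proof
      fix d assume "d \<in> ?L"
      then obtain a c where d: "d = a * c" "a dvd p ^ Suc k" "c dvd e"
        using division_decomp[of d "p ^ Suc k" e] by blast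
      obtain i where i: "i \<le> Suc k" "a = p ^ i"
        using d(2) assms(1) divides_primepow_nat by blast
      show "d \<in> ?R"
      proof (cases "i = Suc k")
        case True
        then show ?thesis
          using d i by auto
      next
        case False
        then have "a dvd p ^ k"
          using i by (simp add: le_imp_power_dvd)
        then show ?thesis
          using d mult_dvd_mono by auto
      qed
    qed
    show "?R \<subseteq> ?L"
      by (auto intro: mult_dvd_mono dvd_mult simp: mult.assoc)
  qed
  have False if "p ^ Suc k * c dvd p ^ k * e" for c
  proof -
    have "p ^ k * (p * c) dvd p ^ k * e"
      using that by (simp add: mult_ac)
    then have "p * c dvd e"
      using \<open>p > 0\<close> by simp
    then show False
      using assms(2) dvd_mult_left by blast
  qed
  then show "{d. d dvd p ^ k * e} \<inter> (\<lambda>c. p ^ Suc k * c) ` {c. c dvd e} = {}"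
    by blast
qed

text \<open>
  Induction over \<open>n = p ^ Suc k * e\<close> with \<open>e\<close> coprime to \<open>p\<close>. Writing \<open>q\<close> for \<open>p\<^sup>m\<close>, the
  divisors of \<open>p ^ k * e\<close> contribute \<open>q ^ k * e\<^sup>m\<close> and the remaining ones
  \<open>(q ^ Suc k - q ^ k) * e\<^sup>m\<close>, so that the terms with \<open>q ^ k\<close> cancel.
\<close>

lemma sum_jordan_totient:
  assumes "n > 0"
  shows "(\<Sum>d | d dvd n. jordan_totient m d) = real n powr m"
  using assms
proof (induction n rule: less_induct)
  case (less n)
  show ?case
  proof (cases "n = 1")
    case True
    then show ?thesis
      by (simp add: jordan_totient_def)
  next
    case False
    then obtain p where p: "prime p" "p dvd n"
      using prime_factor_nat by blast
    have p1: "p > 1"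
      using p(1) prime_gt_1_nat by blast
    obtain j e where je: "n = p ^ j * e" "\<not> p dvd e"
      using multiplicity_decompose'[of n p] less.prems p1
      by (metis less_numeral_extra(3) nat_dvd_1_iff_1 nat_neq_iff)
    with p(2) obtain k where k: "n = p ^ Suc k * e"
      by (cases j) auto
    have "1 < p ^ Suc k"
      using p1 by (rule one_less_power) simp
    moreover have "e > 0"
      using less.prems k by (cases "e = 0") auto
    ultimately have e: "e > 0" "e < n" "p ^ k * e > 0"
      unfolding k using p1 by (auto intro: n_less_m_mult_n)
    have "p ^ k * e < p * (p ^ k * e)"
      using p1 e(3) by (intro n_less_m_mult_n) simp_all
    then have e': "p ^ k * e < n"
      by (simp add: k mult.assoc)
    have "(\<Sum>d | d dvd n. jordan_totient m d)
      = (\<Sum>d | d dvd p ^ k * e. jordan_totient m d)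
        + (\<Sum>d\<in>(\<lambda>c. p ^ Suc k * c) ` {c. c dvd e}. jordan_totient m d)"
      unfolding k divisors_prime_mult(1)[OF p(1) je(2)]
      using e divisors_prime_mult(2)[OF p(1) je(2)] by (intro sum.union_disjoint) auto
    also have "(\<Sum>d\<in>(\<lambda>c. p ^ Suc k * c) ` {c. c dvd e}. jordan_totient m d)
      = (\<Sum>c | c dvd e. jordan_totient m (p ^ Suc k * c))"
      using p1 by (subst sum.reindex) (auto simp: inj_on_def)
    also have "\<dots> = (\<Sum>c | c dvd e.
        (real (p ^ Suc k) powr m - real (p ^ k) powr m) * jordan_totient m c)"
    proof (rule sum.cong[OF refl])
      fix c assume "c \<in> {c. c dvd e}"
      then have "\<not> p dvd c" "c > 0"
        using je(2) e(1) by (auto intro: dvd_trans dvd_pos_nat)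
      then show "jordan_totient m (p ^ Suc k * c)
          = (real (p ^ Suc k) powr m - real (p ^ k) powr m) * jordan_totient m c"
        by (rule jordan_totient_prime_power_mult[OF p(1)])
    qed
    also have "\<dots> = (real (p ^ Suc k) powr m - real (p ^ k) powr m) * real e powr m"
      using less.IH[OF e(2,1)] by (simp flip: sum_distrib_left)
    also have "(\<Sum>d | d dvd p ^ k * e. jordan_totient m d) = real (p ^ k * e) powr m"
      using less.IH[OF e' e(3)] .
    finally show ?thesis
      unfolding k by (simp add: powr_mult algebra_simps)
  qed
qed

section \<open>Quadratic forms of power GCD matrices\<close>

text \<open>
  The convolution identity writes the kernel \<open>gcd(a, b)\<^sup>m\<close> as a combination, with the totients
  as weights, of the rank-one kernels that indicate whether \<open>d\<close> divides both \<open>a\<close> and \<open>b\<close>.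
\<close>

lemma gcd_powr_quadratic_form:
  fixes x :: "'n::finite \<Rightarrow> nat" and w :: "'n \<Rightarrow> real"
  assumes "\<And>i. x i > 0"
  shows "(\<Sum>i\<in>UNIV. \<Sum>j\<in>UNIV. w i * real (gcd (x i) (x j)) powr m * w j)
    = (\<Sum>d\<in>(\<Union>i. {d. d dvd x i}). jordan_totient m d * (\<Sum>i | d dvd x i. w i)\<^sup>2)"
proof -
  define D where "D = (\<Union>i. {d. d dvd x i})"
  have "finite D"
    unfolding D_def using assms by auto
  have gcd_powr: "real (gcd (x i) (x j)) powr m
    = (\<Sum>d\<in>D. jordan_totient m d * of_bool (d dvd x i) * of_bool (d dvd x j))" for i j
  proof -
    have "real (gcd (x i) (x j)) powr m = (\<Sum>d | d dvd gcd (x i) (x j). jordan_totient m d)"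
      using assms[of i] by (intro sum_jordan_totient[symmetric]) auto
    also have "\<dots> = (\<Sum>d\<in>D. jordan_totient m d * of_bool (d dvd x i) * of_bool (d dvd x j))"
      by (rule sum.mono_neutral_cong_left) (use \<open>finite D\<close> in \<open>auto simp: D_def\<close>)
    finally show ?thesis .
  qed
  have restrict: "(\<Sum>i | d dvd x i. w i) = (\<Sum>i\<in>UNIV. of_bool (d dvd x i) * w i)" for d
    by (rule sum.mono_neutral_cong_left) auto
  have "(\<Sum>i\<in>UNIV. \<Sum>j\<in>UNIV. w i * real (gcd (x i) (x j)) powr m * w j)
    = (\<Sum>i\<in>UNIV. \<Sum>j\<in>UNIV. \<Sum>d\<in>D.
        jordan_totient m d * ((of_bool (d dvd x i) * w i) * (of_bool (d dvd x j) * w j)))"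
    unfolding gcd_powr by (simp add: sum_distrib_left sum_distrib_right mult_ac)
  also have "\<dots> = (\<Sum>i\<in>UNIV. \<Sum>d\<in>D. \<Sum>j\<in>UNIV.
        jordan_totient m d * ((of_bool (d dvd x i) * w i) * (of_bool (d dvd x j) * w j)))"
    by (intro sum.cong refl sum.swap)
  also have "\<dots> = (\<Sum>d\<in>D. \<Sum>i\<in>UNIV. \<Sum>j\<in>UNIV.
        jordan_totient m d * ((of_bool (d dvd x i) * w i) * (of_bool (d dvd x j) * w j)))"
    by (rule sum.swap)
  also have "\<dots> = (\<Sum>d\<in>D. jordan_totient m d * (\<Sum>i | d dvd x i. w i)\<^sup>2)"
    unfolding restrict power2_eq_square sum_product by (simp only: sum_distrib_left)
  finally show ?thesis
    unfolding D_def .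
qed

text \<open>
  Distinctness of the \<open>x\<^sub>i\<close> enters here: it isolates one weight in the square for a maximal
  \<open>x\<^sub>i\<close> of nonzero weight, because proper multiples of that \<open>x\<^sub>i\<close> have weight zero.
\<close>

lemma gcd_powr_quadratic_form_pos:
  fixes x :: "'n::finite \<Rightarrow> nat" and w :: "'n \<Rightarrow> real"
  assumes "inj x" "\<And>i. x i > 0" "m > 0" "w k \<noteq> 0"
  shows "(\<Sum>i\<in>UNIV. \<Sum>j\<in>UNIV. w i * real (gcd (x i) (x j)) powr m * w j) > 0"
proof -
  have "Max (x ` {i. w i \<noteq> 0}) \<in> x ` {i. w i \<noteq> 0}"
    using assms(4) by (intro Max_in) auto
  then obtain i where i: "w i \<noteq> 0" and "x i = Max (x ` {i. w i \<noteq> 0})"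
    by auto
  then have max: "x j \<le> x i" if "w j \<noteq> 0" for j
    using that by simp
  have zero: "w j = 0" if "j \<noteq> i" "x i dvd x j" for j
  proof (rule ccontr)
    assume "w j \<noteq> 0"
    then have "x j = x i"
      using max[of j] dvd_imp_le[OF that(2) assms(2)] by simp
    then show False
      using assms(1) that(1) by (simp add: inj_eq)
  qed
  have "(\<Sum>j | x i dvd x j. w j) = (\<Sum>j\<in>{i}. w j)"
    by (rule sum.mono_neutral_right) (auto intro: zero)
  then have square_pos: "(\<Sum>j | x i dvd x j. w j)\<^sup>2 > 0"
    using i by simp
  have totient_pos: "jordan_totient m d > 0" if "d dvd x j" for d j
    using that assms(2)[of j] assms(3) by (intro jordan_totient_pos) (auto intro: dvd_pos_nat)
  show ?thesis
    unfolding gcd_powr_quadratic_form[of x, OF assms(2)]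
  proof (rule sum_pos2[where i = "x i"])
    show "finite (\<Union>i. {d. d dvd x i})"
      using assms(2) by auto
    show "0 < jordan_totient m (x i) * (\<Sum>j | x i dvd x j. w j)\<^sup>2"
      using square_pos totient_pos[OF dvd_refl] by simp
    show "0 \<le> jordan_totient m d * (\<Sum>j | d dvd x j. w j)\<^sup>2"
      if "d \<in> (\<Union>i. {d. d dvd x i})" for d
      using that totient_pos by (force intro: less_imp_le)
    show "x i \<in> (\<Union>i. {d. d dvd x i})"
      by (rule UN_I[of i]) simp_all
  qed
qed

section \<open>Definiteness of matrices\<close>

lemma inner_matrix_vector_mult:
  fixes A :: "real ^ 'n ^ 'n"
  shows "v \<bullet> (A *v v) = (\<Sum>i\<in>UNIV. \<Sum>j\<in>UNIV. v $ i * A $ i $ j * v $ j)"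
  by (simp add: inner_vec_def matrix_vector_mult_def sum_distrib_left mult.assoc)

lemma symmetric_gcd_matrix: "symmetric_matrix (gcd_matrix x f)"
  by (simp add: symmetric_matrix_def gcd_matrix_def transpose_def gcd.commute)

lemma symmetric_lcm_matrix: "symmetric_matrix (lcm_matrix x f)"
  by (simp add: symmetric_matrix_def lcm_matrix_def transpose_def lcm.commute)

lemma positive_definite_lcm_matrix:
  fixes x :: "'n::finite \<Rightarrow> nat"
  assumes "inj x" "\<And>i. x i > 0" "m > 0" "\<And>k. k > 0 \<Longrightarrow> f k = real k powr (- m)"
  shows "positive_definite (lcm_matrix x f)"
  unfolding positive_definite_def
proof (intro conjI allI impI symmetric_lcm_matrix)
  fix v :: "real ^ 'n" assume "v \<noteq> 0"
  then obtain k where "v $ k \<noteq> 0"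
    by (auto simp: vec_eq_iff)
  \<comment> \<open>The substitution absorbs the diagonal factors that separate the LCM from the GCD kernel.\<close>
  define w where "w i = v $ i * real (x i) powr (- m)" for i
  have "w k \<noteq> 0"
    using \<open>v $ k \<noteq> 0\<close> assms(2)[of k] by (simp add: w_def)
  have entry: "v $ i * lcm_matrix x f $ i $ j * v $ j
    = w i * real (gcd (x i) (x j)) powr m * w j" for i j
  proof -
    have "lcm (x i) (x j) > 0"
      using assms(2) by (simp add: lcm_pos_nat)
    have "real (gcd (x i) (x j)) > 0"
      using assms(2)[of i] by simp
    have "real (x i) * real (x j) = real (lcm (x i) (x j)) * real (gcd (x i) (x j))"
      by (metis of_nat_mult prod_gcd_lcm_nat mult.commute)
    then have "real (x i) powr (- m) * real (x j) powr (- m)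
      = real (lcm (x i) (x j)) powr (- m) * real (gcd (x i) (x j)) powr (- m)"
      by (simp flip: powr_mult)
    then have "real (lcm (x i) (x j)) powr (- m)
      = real (x i) powr (- m) * real (gcd (x i) (x j)) powr m * real (x j) powr (- m)"
      using \<open>real (gcd (x i) (x j)) > 0\<close> by (simp add: powr_minus field_simps)
    then show ?thesis
      using assms(4)[OF \<open>lcm (x i) (x j) > 0\<close>] by (simp add: lcm_matrix_def w_def mult_ac)
  qed
  show "v \<bullet> (lcm_matrix x f *v v) > 0"
    unfolding inner_matrix_vector_mult entry
    using gcd_powr_quadratic_form_pos[of x m w k] assms \<open>w k \<noteq> 0\<close> by blast
qed

lemma negative_semidefinite_diagonal_nonpos:
  assumes "negative_semidefinite A"
  shows "A $ i $ i \<le> 0"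
proof -
  have "axis i 1 \<bullet> (A *v axis i 1) = A $ i $ i"
    by (simp add: matrix_vector_mult_basis column_def inner_axis')
  then show ?thesis
    using assms unfolding negative_semidefinite_def by metis
qed

lemma positive_semidefinite_minor_nonneg:
  assumes "positive_semidefinite A" "A $ i $ i > 0"
  shows "(A $ i $ j)\<^sup>2 \<le> A $ i $ i * A $ j $ j"
proof -
  have sym: "A $ j $ i = A $ i $ j"
    using assms(1) unfolding positive_semidefinite_def symmetric_matrix_def transpose_def
    by (metis vec_lambda_beta)
  \<comment> \<open>This vector minimises the form on the line \<open>t e\<^sub>i - A\<^sub>i\<^sub>i e\<^sub>j\<close>, where the form takes the
    value \<open>A\<^sub>i\<^sub>i\<close> times the minor.\<close>
  define v where "v = A $ i $ j *\<^sub>R axis i 1 - A $ i $ i *\<^sub>R axis j (1::real)"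
  have "v \<bullet> (A *v v) = A $ i $ i * (A $ i $ i * A $ j $ j - (A $ i $ j)\<^sup>2)"
    unfolding v_def
    by (simp add: matrix_vector_mult_diff_distrib matrix_vector_mult_scaleR inner_diff_left
        inner_diff_right matrix_vector_mult_basis column_def inner_axis' sym algebra_simps
        power2_eq_square)
  moreover have "v \<bullet> (A *v v) \<ge> 0"
    using assms(1) unfolding positive_semidefinite_def by blast
  ultimately show ?thesis
    using assms(2) by (simp add: zero_le_mult_iff)
qed

lemma gcd_square_less_mult:
  fixes a b :: nat
  assumes "a \<noteq> b" "a > 0" "b > 0"
  shows "(gcd a b)\<^sup>2 < a * b"
proof -
  have "gcd a b \<le> a" "gcd a b \<le> b" "gcd a b > 0"
    using assms by (auto intro: dvd_imp_le)
  then have "gcd a b < a \<or> gcd a b < b"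
    using assms(1) by linarith
  then show ?thesis
    unfolding power2_eq_square
    using \<open>gcd a b \<le> a\<close> \<open>gcd a b \<le> b\<close> \<open>gcd a b > 0\<close>
    by (auto intro: mult_less_le_imp_less mult_le_less_imp_less)
qed

lemma indefinite_gcd_matrix:
  fixes x :: "'n::finite \<Rightarrow> nat"
  assumes "inj x" "\<And>i. x i > 0" "m > 0" "\<And>k. k > 0 \<Longrightarrow> f k = real k powr (- m)"
    and "CARD('n) \<ge> 2"
  shows "indefinite (gcd_matrix x f)"
proof -
  have entry: "gcd_matrix x f $ i $ j = real (gcd (x i) (x j)) powr (- m)" for i j
    using assms(2)[of i] by (simp add: gcd_matrix_def assms(4))
  have diagonal: "gcd_matrix x f $ i $ i > 0" for i
    using assms(2)[of i] by (simp add: entry)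
  obtain i j :: 'n where "i \<noteq> j"
    using assms(5) by (metis card_le_Suc0_iff_eq finite not_less_eq_eq numeral_2_eq_2)
  then have "(gcd (x i) (x j))\<^sup>2 < x i * x j"
    using assms(1,2) by (intro gcd_square_less_mult) (auto simp: inj_eq)
  then have "(real (gcd (x i) (x j)))\<^sup>2 < real (x i) * real (x j)"
    by (metis of_nat_less_iff of_nat_mult of_nat_power)
  then have "(real (x i) * real (x j)) powr (- m) < ((real (gcd (x i) (x j)))\<^sup>2) powr (- m)"
    using assms(2,3) by (intro powr_less_mono2_neg) auto
  then have "gcd_matrix x f $ i $ i * gcd_matrix x f $ j $ j < (gcd_matrix x f $ i $ j)\<^sup>2"
    by (simp add: entry power2_eq_square powr_mult)
  then have "\<not> positive_semidefinite (gcd_matrix x f)"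
    using positive_semidefinite_minor_nonneg[OF _ diagonal] by (meson not_le)
  moreover have "\<not> negative_semidefinite (gcd_matrix x f)"
    using negative_semidefinite_diagonal_nonpos diagonal by (meson not_le)
  ultimately show ?thesis
    unfolding indefinite_def using symmetric_gcd_matrix by blast
qed

theorem theorem5p4:
  fixes x :: "'n::finite \<Rightarrow> nat" and m :: real and f :: "nat \<Rightarrow> real"
  assumes "inj x" and "\<And>i. x i > 0"
    and "m > 0"
    and "\<And>k. k > 0 \<Longrightarrow> f k = real k powr (- m)"
  shows "positive_definite (lcm_matrix x f) \<and>
    (CARD('n) \<ge> 2 \<longrightarrow> indefinite (gcd_matrix x f))"
  using positive_definite_lcm_matrix[OF assms] indefinite_gcd_matrix[OF assms] by blast

end
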